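(* Let $A=(a_{ij})$ be an $n\times n$ Ferrers matrix, and let $x_1,\dots,x_n,y_1,\dots,y_n$ be indeterminates. Let $B(A)=(b_{ij})$ be the $n\times n$ matrix with $b_{ij}=a_{ij}y_j+(1-a_{ij})x_i$. Then $\mathrm{per}(B(A))$ is stable as a polynomial in $\mathbb{C}[x_1,\dots,x_n,y_1,\dots,y_n]$.
   Context: A Ferrers matrix is a $\{0,1\}$-matrix whose entries are weakly decreasing down each column and weakly increasing from left to right across each row. The permanent is $\mathrm{per}(H)=\sum_{\sigma\in S_n}\prod_i h_{i,\sigma(i)}$. A polynomial $f\in\mathbb{C}[u_1,\dots,u_N]$ is stable if $f\equiv 0$ or $f(w_1,\dots,w_N)\ne 0$ whenever all $\mathrm{Im}(w_j)>0$. *)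

theory Defs
  imports
    "HOL-Library.Poly_Mapping"
    "HOL-Combinatorics.Permutations"
    "Jordan_Normal_Form.Matrix"
    Complex_Main
begin

text \<open>
  A polynomial over the complex numbers in indeterminates of type \<open>'v\<close> is a finitely supported
  map from monomials to coefficients, and a monomial is a finitely supported map from
  indeterminates to exponents. The product on \<^typ>\<open>'a \<Rightarrow>\<^sub>0 'b\<close> is convolution, so this is the
  usual commutative polynomial ring. Since \<open>'v\<close> may have infinitely many elements, the ring
  in a given set of indeterminates \<open>V\<close> is carved out by \<open>poly_ring\<close>.
\<close>

type_synonym 'v cpoly = "('v \<Rightarrow>\<^sub>0 nat) \<Rightarrow>\<^sub>0 complex"

definition var :: "'v \<Rightarrow> 'v cpoly" where
  "var v = Poly_Mapping.single (Poly_Mapping.single v 1) 1"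

definition poly_ring :: "'v set \<Rightarrow> 'v cpoly set" where
  "poly_ring V = {f. \<forall>m \<in> Poly_Mapping.keys f. Poly_Mapping.keys m \<subseteq> V}"

definition eval_monom :: "('v \<Rightarrow> complex) \<Rightarrow> ('v \<Rightarrow>\<^sub>0 nat) \<Rightarrow> complex" where
  "eval_monom w m = (\<Prod>v \<in> Poly_Mapping.keys m. w v ^ Poly_Mapping.lookup m v)"

definition eval_poly :: "('v \<Rightarrow> complex) \<Rightarrow> 'v cpoly \<Rightarrow> complex" where
  "eval_poly w f = (\<Sum>m \<in> Poly_Mapping.keys f. Poly_Mapping.lookup f m * eval_monom w m)"

text \<open>
  The point \<open>w\<close> is a total function, but for \<open>f \<in> poly_ring V\<close> the value \<open>eval_poly w f\<close>
  depends only on the restriction of \<open>w\<close> to \<open>V\<close>.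
\<close>

definition stable_poly :: "'v set \<Rightarrow> 'v cpoly \<Rightarrow> bool" where
  "stable_poly V f \<longleftrightarrow> f \<in> poly_ring V \<and>
     (f = 0 \<or> (\<forall>w. (\<forall>v\<in>V. Im (w v) > 0) \<longrightarrow> eval_poly w f \<noteq> 0))"

text \<open>
  Outside square matrices the value is the same default as for the determinant of
  \<open>Jordan_Normal_Form\<close>.
\<close>

definition permanent :: "'a :: comm_semiring_1 mat \<Rightarrow> 'a" where
  "permanent H = (if dim_row H = dim_col H
     then \<Sum>\<sigma> | \<sigma> permutes {0..<dim_row H}. \<Prod>i = 0..<dim_row H. H $$ (i, \<sigma> i)
     else 0)"

definition ferrers_matrix :: "int mat \<Rightarrow> bool" where
  "ferrers_matrix A \<longleftrightarrow>
     (\<forall>i<dim_row A. \<forall>j<dim_col A. A $$ (i, j) \<in> {0, 1}) \<and>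
     (\<forall>i i' j. i \<le> i' \<and> i' < dim_row A \<and> j < dim_col A \<longrightarrow> A $$ (i', j) \<le> A $$ (i, j)) \<and>
     (\<forall>i j j'. i < dim_row A \<and> j \<le> j' \<and> j' < dim_col A \<longrightarrow> A $$ (i, j) \<le> A $$ (i, j'))"

text \<open>
  Matrix indices start at 0, so \<open>X i\<close> and \<open>Y j\<close> stand for $x_{i+1}$ and $y_{j+1}$.
\<close>

datatype indet = X nat | Y nat

definition indets :: "nat \<Rightarrow> indet set" where
  "indets n = X ` {0..<n} \<union> Y ` {0..<n}"

definition B_matrix :: "int mat \<Rightarrow> indet cpoly mat" where
  "B_matrix A = mat (dim_row A) (dim_col A) (\<lambda>(i, j).
     of_int (A $$ (i, j)) * var (Y j) + (1 - of_int (A $$ (i, j))) * var (X i))"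


text \<open>Evaluation at a point is a ring homomorphism.\<close>

lemma eval_poly_superset:
  assumes "finite M" "Poly_Mapping.keys f \<subseteq> M"
  shows "eval_poly w f = (\<Sum>m\<in>M. Poly_Mapping.lookup f m * eval_monom w m)"
  unfolding eval_poly_def
  by (rule sum.mono_neutral_left) (use assms in \<open>auto simp: in_keys_iff\<close>)

lemma eval_monom_superset:
  assumes "finite V" "Poly_Mapping.keys m \<subseteq> V"
  shows "eval_monom w m = (\<Prod>v\<in>V. w v ^ Poly_Mapping.lookup m v)"
  unfolding eval_monom_def
  by (rule prod.mono_neutral_left) (use assms in \<open>auto simp: in_keys_iff\<close>)

lemma eval_monom_add: "eval_monom w (m + m') = eval_monom w m * eval_monom w m'"
proof -
  let ?V = "Poly_Mapping.keys m \<union> Poly_Mapping.keys m'"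
  have "eval_monom w (m + m') = (\<Prod>v\<in>?V. w v ^ Poly_Mapping.lookup (m + m') v)"
    using Poly_Mapping.keys_add[of m m'] by (intro eval_monom_superset) auto
  also have "\<dots> = eval_monom w m * eval_monom w m'"
    by (simp add: eval_monom_superset[of ?V] lookup_add power_add prod.distrib)
  finally show ?thesis .
qed

lemma eval_poly_single [simp]: "eval_poly w (Poly_Mapping.single m c) = c * eval_monom w m"
  by (simp add: eval_poly_def)

lemma eval_poly_zero [simp]: "eval_poly w 0 = 0"
  by (simp add: eval_poly_def)

lemma eval_poly_one [simp]: "eval_poly w 1 = 1"
proof -
  have "eval_poly w (Poly_Mapping.single 0 1) = 1"
    unfolding eval_poly_single by (simp add: eval_monom_def)
  then show ?thesis by simp
qed

lemma eval_poly_var [simp]: "eval_poly w (var v) = w v"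
  by (simp add: var_def eval_monom_def)

lemma eval_poly_add: "eval_poly w (f + g) = eval_poly w f + eval_poly w g"
proof -
  let ?M = "Poly_Mapping.keys f \<union> Poly_Mapping.keys g"
  have "eval_poly w (f + g) = (\<Sum>m\<in>?M. Poly_Mapping.lookup (f + g) m * eval_monom w m)"
    using Poly_Mapping.keys_add[of f g] by (intro eval_poly_superset) auto
  also have "\<dots> = eval_poly w f + eval_poly w g"
    by (simp add: eval_poly_superset[of ?M] lookup_add distrib_right sum.distrib)
  finally show ?thesis .
qed

lemma eval_poly_sum: "eval_poly w (sum f S) = (\<Sum>s\<in>S. eval_poly w (f s))"
  by (induction S rule: infinite_finite_induct) (auto simp: eval_poly_add)

lemma cpoly_expansion:
  "f = (\<Sum>m\<in>Poly_Mapping.keys f. Poly_Mapping.single m (Poly_Mapping.lookup f m))"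
  by (rule poly_mapping_eqI)
    (auto simp: lookup_sum lookup_single when_def sum.delta in_keys_iff)

lemma eval_poly_mult: "eval_poly w (f * g) = eval_poly w f * eval_poly w g"
proof -
  have "f * g = (\<Sum>m\<in>Poly_Mapping.keys f. Poly_Mapping.single m (Poly_Mapping.lookup f m)) *
                (\<Sum>m\<in>Poly_Mapping.keys g. Poly_Mapping.single m (Poly_Mapping.lookup g m))"
    using cpoly_expansion[of f] cpoly_expansion[of g] by simp
  then show ?thesis
    by (simp add: eval_poly_sum sum_product mult_single eval_monom_add mult_ac
        eval_poly_def[of w f] eval_poly_def[of w g])
qed

lemma eval_poly_prod: "eval_poly w (prod f S) = (\<Prod>s\<in>S. eval_poly w (f s))"
  by (induction S rule: infinite_finite_induct) (auto simp: eval_poly_mult)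

end

(* Let P be the permanent for the upper left (n-1) x (n-1) block. If the corner entry a_nn is 1, the
   whole last column equals y_n, and removing the last column by a transposition gives
     per B(A) = y_n (c P + x_n D P),
   where c >= 1 is the number of ones in the last row and D is a sum of partial derivatives
   (in all x_i and in the y_j with a_nj = 0). As P is affine in each variable and does not vanish
   on the upper half plane, Im (D P / P) <= 0 there, whereas a zero would force
   D P / P = - c / x_n, which has positive imaginary part. The case a_nn = 0 reduces to this one by
   transposing, complementing A and exchanging the x_i with the y_j. *)
theory Submission
  imports Defs
begin

section \<open>Permanents of functions\<close>

text \<open>Each permutation of \<open>{..<Suc n}\<close> is uniquely
  \<open>transpose n b \<circ> q\<close> with \<open>q\<close> permuting \<open>{..<n}\<close>. If b
  = n, it fixes n; if b = q i, it sends n to \<open>q i\<close> and i to n and otherwise agrees with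
  \<open>q\<close>. Keeping \<open>q\<close> as the index, instead of passing to minors, lets every
  term be compared with the product that \<open>q\<close> contributes to the smaller
  permanent.\<close>

lemma sum_permutations_lessThan_Suc:
  fixes M :: "nat \<Rightarrow> nat \<Rightarrow> 'a :: comm_semiring_1"
  shows "(\<Sum>p | p permutes {..<Suc n}. \<Prod>i<Suc n. M i (p i)) =
    (\<Sum>q | q permutes {..<n}. (\<Prod>i<n. M i (q i)) * M n n +
        (\<Sum>i<n. M n (q i) * M i n * (\<Prod>k\<in>{..<n} - {i}. M k (q k))))"
proof -
  have inner: "(\<Sum>b\<in>insert n {..<n}. \<Prod>i<Suc n. M i ((transpose n b \<circ> q) i)) =
      (\<Prod>i<n. M i (q i)) * M n n + (\<Sum>i<n. M n (q i) * M i n * (\<Prod>k\<in>{..<n} - {i}. M k (q k)))"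
    if q: "q permutes {..<n}" for q
  proof -
    have qn: "q n = n"
      using permutes_not_in[OF q] by auto
    have bij: "bij_betw q {..<n} {..<n}"
      by (rule permutes_imp_bij[OF q])
    have q_less: "q k < n" if "k < n" for k
      using bij that by (auto simp: bij_betw_def)
    have "(\<Prod>k<Suc n. M k ((transpose n (q i) \<circ> q) k)) =
        M n (q i) * M i n * (\<Prod>k\<in>{..<n} - {i}. M k (q k))" if i: "i < n" for i
    proof -
      have rest: "(\<Prod>k\<in>{..<n} - {i}. M k ((transpose n (q i) \<circ> q) k)) = (\<Prod>k\<in>{..<n} - {i}. M k (q k))"
      proof (rule prod.cong)
        fix k assume k: "k \<in> {..<n} - {i}"
        have "q k \<noteq> q i"
          using bij k i by (auto simp: bij_betw_def inj_on_def)
        moreover have "q k \<noteq> n"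
          using k q_less[of k] by auto
        ultimately show "M k ((transpose n (q i) \<circ> q) k) = M k (q k)"
          by simp
      qed simp
      have "(\<Prod>k<Suc n. M k ((transpose n (q i) \<circ> q) k)) =
          (\<Prod>k<n. M k ((transpose n (q i) \<circ> q) k)) * M n (q i)"
        using qn by simp
      also have "(\<Prod>k<n. M k ((transpose n (q i) \<circ> q) k)) =
          M i n * (\<Prod>k\<in>{..<n} - {i}. M k (q k))"
        unfolding rest[symmetric] using i by (subst prod.remove[of _ i]) auto
      finally show ?thesis
        by (simp add: mult_ac)
    qed
    \<comment> \<open>The column b is renamed by the row i that \<open>q\<close> sends to
      it.\<close>
    moreover have "(\<Sum>b<n. \<Prod>k<Suc n. M k ((transpose n b \<circ> q) k)) =
        (\<Sum>i<n. \<Prod>k<Suc n. M k ((transpose n (q i) \<circ> q) k))"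
      by (rule sum.reindex_bij_betw[OF bij, symmetric])
    moreover have "(\<Prod>k<Suc n. M k ((transpose n n \<circ> q) k)) = (\<Prod>k<n. M k (q k)) * M n n"
      using qn by simp
    ultimately show ?thesis
      by simp
  qed
  have "(\<Sum>p | p permutes {..<Suc n}. \<Prod>i<Suc n. M i (p i)) =
      (\<Sum>b\<in>insert n {..<n}. \<Sum>q | q permutes {..<n}. \<Prod>i<Suc n. M i ((transpose n b \<circ> q) i))"
    unfolding lessThan_Suc by (rule sum_over_permutations_insert) auto
  also have "\<dots> = (\<Sum>q | q permutes {..<n}. \<Sum>b\<in>insert n {..<n}. \<Prod>i<Suc n. M i ((transpose n b \<circ> q) i))"
    by (rule sum.swap)
  also have "\<dots> = (\<Sum>q | q permutes {..<n}. (\<Prod>i<n. M i (q i)) * M n n +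
        (\<Sum>i<n. M n (q i) * M i n * (\<Prod>k\<in>{..<n} - {i}. M k (q k))))"
    by (rule sum.cong) (use inner in auto)
  finally show ?thesis .
qed

section \<open>Ferrers permanents and the symmetry under complement and transposition\<close>

definition weight :: "(nat \<Rightarrow> nat \<Rightarrow> bool) \<Rightarrow> (nat \<Rightarrow> 'a) \<Rightarrow> (nat \<Rightarrow> 'a) \<Rightarrow> nat \<Rightarrow> nat \<Rightarrow> 'a" where
  "weight a x y i j = (if a i j then y j else x i)"

text \<open>The arguments \<open>x\<close>, \<open>y\<close> lie in any commutative semiring, so
  that one formula covers both the indeterminates and their complex values. A boolean
  \<open>a\<close> makes complementing a negation.\<close>

definition ferrers_per ::
  "(nat \<Rightarrow> nat \<Rightarrow> bool) \<Rightarrow> nat \<Rightarrow> (nat \<Rightarrow> 'a) \<Rightarrow> (nat \<Rightarrow> 'a) \<Rightarrow> 'a :: comm_semiring_1" where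
  "ferrers_per a n x y = (\<Sum>q | q permutes {..<n}. \<Prod>i<n. weight a x y i (q i))"

definition ferrers_shape :: "(nat \<Rightarrow> nat \<Rightarrow> bool) \<Rightarrow> nat \<Rightarrow> bool" where
  "ferrers_shape a n \<longleftrightarrow>
     (\<forall>i i' j. i \<le> i' \<and> i' < n \<and> j < n \<and> a i' j \<longrightarrow> a i j) \<and>
     (\<forall>i j j'. i < n \<and> j \<le> j' \<and> j' < n \<and> a i j \<longrightarrow> a i j')"

lemma ferrers_shape_dual: "ferrers_shape a n \<Longrightarrow> ferrers_shape (\<lambda>i j. \<not> a j i) n"
  unfolding ferrers_shape_def by blast

lemma ferrers_shape_Suc: "ferrers_shape a (Suc n) \<Longrightarrow> ferrers_shape a n"
  unfolding ferrers_shape_def by (meson less_SucI)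

lemma weight_dual: "weight (\<lambda>i j. \<not> a j i) y x j i = weight a x y i j"
  by (simp add: weight_def)

text \<open>Complementing and exchanging \<open>x\<close> with \<open>y\<close> just transposes the
  matrix of weights, and a permanent is invariant under transposition: sum over inverse
  permutations.\<close>

lemma ferrers_per_dual: "ferrers_per (\<lambda>i j. \<not> a j i) n y x = ferrers_per a n x y"
proof -
  have "(\<Prod>i<n. weight (\<lambda>i j. \<not> a j i) y x i (inv_into UNIV q i)) = (\<Prod>i<n. weight a x y i (q i))"
    if q: "q permutes {..<n}" for q
  proof -
    have "(\<Prod>i<n. weight (\<lambda>i j. \<not> a j i) y x i (inv_into UNIV q i)) =
        (\<Prod>i<n. weight (\<lambda>i j. \<not> a j i) y x (q i) (inv_into UNIV q (q i)))"
      by (rule prod.reindex_bij_betw[OF permutes_imp_bij[OF q], symmetric])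
    also have "\<dots> = (\<Prod>i<n. weight a x y i (q i))"
      by (simp add: weight_dual permutes_inverses(2)[OF q])
    finally show ?thesis .
  qed
  then show ?thesis
    unfolding ferrers_per_def by (subst sum_permutations_inverse) simp
qed

section \<open>Partial derivatives\<close>

text \<open>The partial derivative of \<open>ferrers_per\<close> in \<open>x i\<close>: this
  variable occurs only in row i, hence at most once in each product, and differentiating deletes
  that factor.\<close>

definition ferrers_per_dx ::
  "(nat \<Rightarrow> nat \<Rightarrow> bool) \<Rightarrow> nat \<Rightarrow> (nat \<Rightarrow> 'a) \<Rightarrow> (nat \<Rightarrow> 'a) \<Rightarrow> nat \<Rightarrow> 'a :: comm_semiring_1" where
  "ferrers_per_dx a n x y i = (\<Sum>q | q permutes {..<n}.
     if a i (q i) then 0 else \<Prod>k\<in>{..<n} - {i}. weight a x y k (q k))"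

text \<open>The inner sum has at most one nonzero term, namely for the row of column \<open>j\<close>.\<close>

definition ferrers_per_dy ::
  "(nat \<Rightarrow> nat \<Rightarrow> bool) \<Rightarrow> nat \<Rightarrow> (nat \<Rightarrow> 'a) \<Rightarrow> (nat \<Rightarrow> 'a) \<Rightarrow> nat \<Rightarrow> 'a :: comm_semiring_1" where
  "ferrers_per_dy a n x y j = (\<Sum>q | q permutes {..<n}. \<Sum>i<n.
     if q i = j \<and> a i j then \<Prod>k\<in>{..<n} - {i}. weight a x y k (q k) else 0)"

text \<open>Transposition turns column j into row j, so facts about derivatives in
  \<open>y j\<close> follow from those in \<open>x j\<close>.\<close>

lemma ferrers_per_dx_dual:
  assumes "j < n"
  shows "ferrers_per_dx (\<lambda>i j. \<not> a j i) n y x j = ferrers_per_dy a n x y j"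
proof -
  have "(if \<not> a (inv_into UNIV q j) j then 0
         else \<Prod>k\<in>{..<n} - {j}. weight (\<lambda>i j. \<not> a j i) y x k (inv_into UNIV q k)) =
      (\<Sum>i<n. if q i = j \<and> a i j then \<Prod>k\<in>{..<n} - {i}. weight a x y k (q k) else 0)"
    if q: "q permutes {..<n}" for q
  proof -
    have q_inv: "inv_into UNIV q (q k) = k" "q (inv_into UNIV q k) = k" for k
      using permutes_inverses[OF q] by auto
    \<comment> \<open>This collapses the sum over rows to the single row that \<open>q\<close> sends
      to column j.\<close>
    have eq: "q i = j \<longleftrightarrow> i = inv_into UNIV q j" for i
      using q_inv by metis
    have "inv_into UNIV q j < n"
      using permutes_in_image[OF permutes_inv[OF q], of j] assms by simp
    moreover have "bij_betw q ({..<n} - {inv_into UNIV q j}) ({..<n} - {j})"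
      using bij_betw_DiffI[OF permutes_imp_bij[OF q], of "{inv_into UNIV q j}" "{j}"] q_inv assms \<open>inv_into UNIV q j < n\<close>
      by (auto simp: bij_betw_def)
    then have "(\<Prod>k\<in>{..<n} - {j}. weight (\<lambda>i j. \<not> a j i) y x k (inv_into UNIV q k)) =
        (\<Prod>k\<in>{..<n} - {inv_into UNIV q j}. weight (\<lambda>i j. \<not> a j i) y x (q k) (inv_into UNIV q (q k)))"
      by (rule prod.reindex_bij_betw[symmetric])
    ultimately show ?thesis
      by (simp add: eq q_inv weight_dual if_distrib sum.delta cong: conj_cong if_cong)
  qed
  then show ?thesis
    unfolding ferrers_per_dx_def ferrers_per_dy_def
    by (subst sum_permutations_inverse) (rule sum.cong, auto)
qed

text \<open>The permanent is affine in \<open>x i\<close>, so the first-order expansion is exact.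
  Read from right to left, it turns an affine function of t into a permanent at a modified point,
  where nonvanishing is known.\<close>

lemma ferrers_per_update_x:
  fixes x y :: "nat \<Rightarrow> 'a :: comm_ring_1"
  assumes "i < n"
  shows "ferrers_per a n (x(i := t)) y = ferrers_per a n x y + (t - x i) * ferrers_per_dx a n x y i"
proof -
  have "(\<Prod>k<n. weight a (x(i := t)) y k (q k)) = (\<Prod>k<n. weight a x y k (q k)) +
      (t - x i) * (if a i (q i) then 0 else \<Prod>k\<in>{..<n} - {i}. weight a x y k (q k))" for q
  proof -
    have "(\<Prod>k\<in>{..<n} - {i}. weight a (x(i := t)) y k (q k)) =
        (\<Prod>k\<in>{..<n} - {i}. weight a x y k (q k))"
      by (rule prod.cong) (auto simp: weight_def)
    moreover have "(\<Prod>k<n. f k) = f i * (\<Prod>k\<in>{..<n} - {i}. f k)" for f :: "nat \<Rightarrow> 'a"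
      using assms by (simp add: prod.remove)
    ultimately show ?thesis
      by (auto simp: weight_def[of _ _ _ i] algebra_simps)
  qed
  then show ?thesis
    by (simp add: ferrers_per_def ferrers_per_dx_def sum.distrib sum_distrib_left)
qed

lemma ferrers_per_update_y:
  fixes x y :: "nat \<Rightarrow> 'a :: comm_ring_1"
  assumes "j < n"
  shows "ferrers_per a n x (y(j := t)) = ferrers_per a n x y + (t - y j) * ferrers_per_dy a n x y j"
  using ferrers_per_update_x[OF assms, of "\<lambda>i j. \<not> a j i" y t x]
  by (simp add: ferrers_per_dual ferrers_per_dx_dual[OF assms])

text \<open>For fixed \<open>q\<close> and i, the last row contributes its entry in column
  \<open>q i\<close>. If \<open>a n (q i)\<close>, row i also has a one there, both weights are
  \<open>y (q i)\<close>, and the full product of \<open>q\<close> is restored. Otherwise the factor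
  is \<open>x n\<close>, and the remaining product belongs to the derivative in \<open>x i\<close>
  or in \<open>y (q i)\<close>, according to \<open>a i (q i)\<close>. The corner entry accounts for
  the \<open>Suc\<close>.\<close>

lemma ferrers_per_Suc:
  assumes a: "ferrers_shape a (Suc n)" and ann: "a n n"
  shows "ferrers_per a (Suc n) x y =
    y n * (of_nat (Suc (card {j. j < n \<and> a n j})) * ferrers_per a n x y +
      x n * ((\<Sum>i<n. ferrers_per_dx a n x y i) + (\<Sum>j | j < n \<and> \<not> a n j. ferrers_per_dy a n x y j)))"
proof -
  let ?c = "card {j. j < n \<and> a n j}"
  let ?J = "{j. j < n \<and> \<not> a n j}"
  define R where "R q i = (\<Prod>k\<in>{..<n} - {i}. weight a x y k (q k))" for q i
  define P where "P q = (\<Prod>k<n. weight a x y k (q k))" for q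
  have col: "a i n" if "i \<le> n" for i
    using a ann that unfolding ferrers_shape_def by blast
  have row: "a i j" if "a n j" "i < n" "j < n" for i j
    using a that unfolding ferrers_shape_def by (metis less_Suc_eq less_imp_le)
  have main: "P q * y n + (\<Sum>i<n. weight a x y n (q i) * y n * R q i) =
      y n * (of_nat (Suc ?c) * P q + x n * ((\<Sum>i<n. if a i (q i) then 0 else R q i) +
        (\<Sum>j\<in>?J. \<Sum>i<n. if q i = j \<and> a i j then R q i else 0)))"
    if q: "q permutes {..<n}" for q
  proof -
    have bij: "bij_betw q {..<n} {..<n}"
      by (rule permutes_imp_bij[OF q])
    have q_less: "q i < n" if "i < n" for i
      using bij that by (auto simp: bij_betw_def)
    have P: "P q = weight a x y i (q i) * R q i" if "i < n" for i
      unfolding P_def R_def using that by (simp add: prod.remove)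
    have swap: "(\<Sum>j\<in>?J. \<Sum>i<n. if q i = j \<and> a i j then R q i else 0) =
        (\<Sum>i<n. if a i (q i) \<and> \<not> a n (q i) then R q i else 0)"
    proof -
      have "(\<Sum>j\<in>?J. if q i = j \<and> a i j then R q i else 0) =
          (\<Sum>j\<in>?J. if q i = j then (if a i (q i) then R q i else 0) else 0)" for i
        by (rule sum.cong) auto
      then show ?thesis
        by (subst sum.swap) (rule sum.cong, auto simp: q_less)
    qed
    \<comment> \<open>As \<open>q\<close> is a bijection, it meets each one of the last row exactly
      once.\<close>
    have count: "(\<Sum>i<n. if a n (q i) then P q else 0) = of_nat ?c * P q"
    proof -
      have "(\<Sum>i<n. if a n (q i) then P q else 0) = (\<Sum>j<n. if a n j then P q else 0)"
        by (rule sum.reindex_bij_betw[OF bij])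
      also have "\<dots> = (\<Sum>j\<in>{j. j < n \<and> a n j}. P q)"
        by (subst sum.inter_filter[symmetric]) auto
      finally show ?thesis by simp
    qed
    have "weight a x y n (q i) * y n * R q i = y n * ((if a n (q i) then P q else 0) +
        x n * ((if a i (q i) then 0 else R q i) +
          (if a i (q i) \<and> \<not> a n (q i) then R q i else 0)))" if i: "i < n" for i
      using row[of "q i" i] i q_less[OF i] P[OF i] by (auto simp: weight_def mult_ac)
    then have "(\<Sum>i<n. weight a x y n (q i) * y n * R q i) =
        (\<Sum>i<n. y n * ((if a n (q i) then P q else 0) +
          x n * ((if a i (q i) then 0 else R q i) +
            (if a i (q i) \<and> \<not> a n (q i) then R q i else 0))))"
      by (intro sum.cong) auto
    also have "\<dots> = y n * (of_nat ?c * P q + x n * ((\<Sum>i<n. if a i (q i) then 0 else R q i) +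
        (\<Sum>j\<in>?J. \<Sum>i<n. if q i = j \<and> a i j then R q i else 0)))"
      unfolding count[symmetric] swap by (simp only: sum_distrib_left[symmetric] sum.distrib)
    finally show ?thesis
      by (simp add: algebra_simps)
  qed
  have "ferrers_per a (Suc n) x y =
      (\<Sum>q | q permutes {..<n}. P q * y n + (\<Sum>i<n. weight a x y n (q i) * y n * R q i))"
    unfolding ferrers_per_def sum_permutations_lessThan_Suc P_def R_def
    using col by (intro sum.cong refl arg_cong2[where f = "(+)"]) (auto simp: weight_def)
  also have "\<dots> = (\<Sum>q | q permutes {..<n}.
      y n * (of_nat (Suc ?c) * P q + x n * ((\<Sum>i<n. if a i (q i) then 0 else R q i) +
        (\<Sum>j\<in>?J. \<Sum>i<n. if q i = j \<and> a i j then R q i else 0))))"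
    using main by (intro sum.cong) auto
  also have "\<dots> = y n * (of_nat (Suc ?c) * (\<Sum>q | q permutes {..<n}. P q) +
      x n * ((\<Sum>i<n. \<Sum>q | q permutes {..<n}. if a i (q i) then 0 else R q i) +
        (\<Sum>j\<in>?J. \<Sum>q | q permutes {..<n}. \<Sum>i<n. if q i = j \<and> a i j then R q i else 0)))"
    by (simp only: sum_distrib_left[symmetric] sum.distrib
        sum.swap[of _ _ "{q. q permutes {..<n}}"])
  finally show ?thesis
    unfolding ferrers_per_def ferrers_per_dx_def ferrers_per_dy_def P_def R_def .
qed

section \<open>Nonvanishing on the upper half plane\<close>

text \<open>If d / p had positive imaginary part, p / d would have a negative one, and the root z -
  p / d of the affine function would lie in the upper half plane.\<close>

lemma Im_log_derivative_nonpos: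
  fixes p d z :: complex
  assumes z: "Im z > 0" and nz: "\<And>t. Im t > 0 \<Longrightarrow> p + (t - z) * d \<noteq> 0"
  shows "Im (d / p) \<le> 0"
proof (rule ccontr)
  assume "\<not> Im (d / p) \<le> 0"
  then have pos: "Im (d / p) > 0" and "d \<noteq> 0" "p \<noteq> 0"
    by auto
  have "Im (p / d) = Im (inverse (d / p))"
    by simp
  also have "\<dots> = - Im (d / p) / (cmod (d / p))\<^sup>2"
    by (simp add: cmod_power2 del: inverse_divide)
  also have "\<dots> \<le> 0"
    using pos by (simp add: divide_nonpos_nonneg)
  finally have "Im (z - p / d) > 0"
    using z by simp
  with nz[of "z - p / d"] show False
    using \<open>d \<noteq> 0\<close> by simp
qed

lemma ferrers_per_nonzero:
  fixes x y :: "nat \<Rightarrow> complex"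
  assumes "ferrers_shape a n" and "\<And>i. i < n \<Longrightarrow> Im (x i) > 0" and "\<And>j. j < n \<Longrightarrow> Im (y j) > 0"
  shows "ferrers_per a n x y \<noteq> 0"
  using assms
\<comment> \<open>The induction hypothesis is needed at points with one coordinate changed and for
  the complemented transpose of \<open>a\<close>.\<close>
proof (induction n arbitrary: a x y)
  case 0
  show ?case
    by (simp add: ferrers_per_def)
next
  case (Suc n)
  have step: "ferrers_per b (Suc n) u v \<noteq> 0"
    if b: "ferrers_shape b (Suc n)" "b n n"
      and u: "\<And>i. i < Suc n \<Longrightarrow> Im (u i) > 0" and v: "\<And>j. j < Suc n \<Longrightarrow> Im (v j) > 0"
    for b and u v :: "nat \<Rightarrow> complex"
  proof -
    define p where "p = ferrers_per b n u v"
    define d where "d = (\<Sum>i<n. ferrers_per_dx b n u v i) +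
      (\<Sum>j | j < n \<and> \<not> b n j. ferrers_per_dy b n u v j)"
    define c where "c = Suc (card {j. j < n \<and> b n j})"
    note IH = Suc.IH[OF ferrers_shape_Suc[OF b(1)]]
    have p: "p \<noteq> 0"
      unfolding p_def using u v by (intro IH) auto
    \<comment> \<open>Replacing one coordinate by any t in the upper half plane gives another point
      to which \<open>IH\<close> applies, so the affine function of t has no root there.\<close>
    have dx: "Im (ferrers_per_dx b n u v i / p) \<le> 0" if i: "i < n" for i
      unfolding p_def
      by (rule Im_log_derivative_nonpos[of "u i"], use u i in force,
          unfold ferrers_per_update_x[OF i, symmetric], rule IH) (use u v in auto)
    have dy: "Im (ferrers_per_dy b n u v j / p) \<le> 0" if j: "j < n" for j
      unfolding p_def
      by (rule Im_log_derivative_nonpos[of "v j"], use v j in force,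
          unfold ferrers_per_update_y[OF j, symmetric], rule IH) (use u v in auto)
    have "d / p = (\<Sum>i<n. ferrers_per_dx b n u v i / p) +
        (\<Sum>j | j < n \<and> \<not> b n j. ferrers_per_dy b n u v j / p)"
      by (simp add: d_def add_divide_distrib sum_divide_distrib)
    then have d: "Im (d / p) \<le> 0"
      using dx dy by (auto simp: Im_sum intro!: add_nonpos_nonpos sum_nonpos)
    have "of_nat c * p + u n * d \<noteq> 0"
    proof
      assume "of_nat c * p + u n * d = 0"
      moreover have un: "u n \<noteq> 0"
        using u[of n] by auto
      ultimately have "d / p = - (of_nat c / u n)"
        using p by (simp add: field_simps add_eq_0_iff)
      \<comment> \<open>Strictness comes from \<open>c\<close> being a successor, hence
        positive.\<close>
      moreover have "Im (of_nat c / u n) < 0"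
        using u[of n] by (simp add: Im_divide c_def divide_neg_pos sum_power2_gt_zero_iff
            mult_pos_pos del: of_nat_Suc)
      ultimately show False
        using d by simp
    qed
    moreover have "v n \<noteq> 0"
      using v[of n] by auto
    ultimately show ?thesis
      unfolding ferrers_per_Suc[OF b] p_def d_def c_def by simp
  qed
  show ?case
  proof (cases "a n n")
    case True
    then show ?thesis
      using step Suc.prems by blast
  next
    case False
    \<comment> \<open>The complemented transpose has a one in the corner, so \<open>step\<close>
      applies with the two families of variables exchanged.\<close>
    then have "ferrers_per (\<lambda>i j. \<not> a j i) (Suc n) y x \<noteq> 0"
      using Suc.prems by (intro step ferrers_shape_dual) auto
    then show ?thesis
      by (simp add: ferrers_per_dual)
  qed
qed

section \<open>The polynomial ring in a set of indeterminates\<close>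

lemma var_in_poly_ring: "v \<in> V \<Longrightarrow> var v \<in> poly_ring V"
  by (auto simp: var_def poly_ring_def split: if_splits)

lemma sum_in_poly_ring: "(\<And>s. s \<in> S \<Longrightarrow> f s \<in> poly_ring V) \<Longrightarrow> sum f S \<in> poly_ring V"
proof (induction S rule: infinite_finite_induct)
  case (insert s S)
  then show ?case
    using Poly_Mapping.keys_add[of "f s" "sum f S"] by (auto simp: poly_ring_def)
qed (auto simp: poly_ring_def)

lemma mult_in_poly_ring:
  assumes "f \<in> poly_ring V" "g \<in> poly_ring V"
  shows "f * g \<in> poly_ring V"
  unfolding poly_ring_def
proof safe
  fix m v assume "m \<in> Poly_Mapping.keys (f * g)" and v: "v \<in> Poly_Mapping.keys m"
  then obtain k l where "k \<in> Poly_Mapping.keys f" "l \<in> Poly_Mapping.keys g" "m = k + l"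
    using keys_mult[of f g] by blast
  with v show "v \<in> V"
    using Poly_Mapping.keys_add[of k l] assms unfolding poly_ring_def by blast
qed

lemma prod_in_poly_ring: "(\<And>s. s \<in> S \<Longrightarrow> f s \<in> poly_ring V) \<Longrightarrow> prod f S \<in> poly_ring V"
proof (induction S rule: infinite_finite_induct)
  case (insert s S)
  then show ?case
    by (simp add: mult_in_poly_ring)
qed (auto simp: poly_ring_def)

text \<open>Since the entries of \<open>A\<close> are 0 or 1, each combination in
  \<open>B_matrix\<close> reduces to a single indeterminate.\<close>

lemma permanent_B_matrix:
  assumes "A \<in> carrier_mat n n" "ferrers_matrix A"
  shows "permanent (B_matrix A) =
    ferrers_per (\<lambda>i j. A $$ (i, j) = 1) n (\<lambda>i. var (X i)) (\<lambda>j. var (Y j))"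
proof -
  have dim: "dim_row A = n" "dim_col A = n"
    using assms by auto
  have "B_matrix A $$ (i, q i) =
      weight (\<lambda>i j. A $$ (i, j) = 1) (\<lambda>i. var (X i)) (\<lambda>j. var (Y j)) i (q i)"
    if "q permutes {..<n}" "i < n" for q i
  proof -
    have "q i < n"
      using permutes_in_image[OF that(1), of i] that(2) by simp
    with that assms(2) have "A $$ (i, q i) = 0 \<or> A $$ (i, q i) = 1"
      unfolding ferrers_matrix_def dim by blast
    with that \<open>q i < n\<close> show ?thesis
      by (auto simp: B_matrix_def weight_def dim)
  qed
  then show ?thesis
    unfolding permanent_def ferrers_per_def
    by (simp add: B_matrix_def[of A] dim atLeast0LessThan flip: B_matrix_def)
qed

theorem theorem3p4:
  fixes A :: "int mat" and n :: nat
  assumes "A \<in> carrier_mat n n"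
    and "ferrers_matrix A"
  shows "stable_poly (indets n) (permanent (B_matrix A))"
proof -
  let ?a = "\<lambda>i j. A $$ (i, j) = 1"
  have dim: "dim_row A = n" "dim_col A = n"
    using assms by auto
  have in_ring: "permanent (B_matrix A) \<in> poly_ring (indets n)"
    unfolding permanent_B_matrix[OF assms] ferrers_per_def
  proof (intro sum_in_poly_ring prod_in_poly_ring)
    fix q i assume "q \<in> {q. q permutes {..<n}}" "i \<in> {..<n}"
    moreover from this have "q i < n"
      using permutes_in_image[of q "{..<n}" i] by simp
    ultimately show "weight ?a (\<lambda>i. var (X i)) (\<lambda>j. var (Y j)) i (q i) \<in> poly_ring (indets n)"
      by (auto simp: weight_def indets_def intro!: var_in_poly_ring)
  qed
  \<comment> \<open>For entries in {0, 1}, the inequalities between entries become implications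
    between being equal to 1.\<close>
  have shape: "ferrers_shape ?a n"
    unfolding ferrers_shape_def
  proof (intro conjI allI impI)
    fix i i' j assume *: "i \<le> i' \<and> i' < n \<and> j < n \<and> ?a i' j"
    then have "A $$ (i', j) \<le> A $$ (i, j)" "A $$ (i, j) \<in> {0, 1}"
      using assms(2) unfolding ferrers_matrix_def dim by (meson le_less_trans)+
    with * show "?a i j" by auto
  next
    fix i j j' assume *: "i < n \<and> j \<le> j' \<and> j' < n \<and> ?a i j"
    then have "A $$ (i, j) \<le> A $$ (i, j')" "A $$ (i, j') \<in> {0, 1}"
      using assms(2) unfolding ferrers_matrix_def dim by (meson le_less_trans)+
    with * show "?a i j'" by auto
  qed
  have "eval_poly w (permanent (B_matrix A)) \<noteq> 0" if w: "\<forall>v\<in>indets n. Im (w v) > 0" for w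
  proof -
    \<comment> \<open>Evaluation commutes with the choice of a variable, and being a ring
      homomorphism it carries the polynomial permanent to the complex one.\<close>
    have "eval_poly w (weight ?a (\<lambda>i. var (X i)) (\<lambda>j. var (Y j)) i j) =
        weight ?a (\<lambda>i. w (X i)) (\<lambda>j. w (Y j)) i j" for i j
      by (simp add: weight_def)
    then have "eval_poly w (permanent (B_matrix A)) =
        ferrers_per ?a n (\<lambda>i. w (X i)) (\<lambda>j. w (Y j))"
      by (simp add: permanent_B_matrix[OF assms] ferrers_per_def eval_poly_sum eval_poly_prod)
    also have "\<dots> \<noteq> 0"
      using w by (intro ferrers_per_nonzero[OF shape]) (auto simp: indets_def)
    finally show ?thesis .
  qed
  with in_ring show ?thesis
    unfolding stable_poly_def by blast
qed

end
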